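(* Let $\tau$ be a topology on $X$ and $F\colon X\to Y$ a mapping. Let $y\in Y$ be such that there exists $x\in X$ with $F(x)=y$ and $\mathcal R(x)<\infty$, and assume that $\Phi_{\mathcal R}(F,w,\gamma,t)$ is $\tau$-compact for all $w\in Y$ and $\gamma,t\ge0$. If $(y_k)_{k\in\mathbb N}\subset Y$ converges $\mathcal S$-uniformly to $y$ and satisfies $\mathcal S(y,y_k)\le\beta_k\to0$, then \[ \limsup_{k\to\infty}v(F,y_k,\beta_k)\le v(F,y,0)<\infty . \] In particular, \[ \emptyset\ne\tau_{\mathcal R}\text{-}\limsup_{k\to\infty}\Sigma(F,y_k,\beta_k)\subset\Sigma(F,y,0). \] If, additionally, the $\mathcal R$-minimizing solution $x^\dagger$ of $F(x)=y$ is unique (that is, $\Sigma(F,y,0)=\{x^\dagger\}$), then \[ \{x^\dagger\}=\tau_{\mathcal R}\text{-}\limsup_{k\to\infty}\Sigma(F,y_k,\beta_k). \]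
   Context: $X$ and $Y$ are sets, $\mathcal R\colon X\to[0,+\infty]$ is a functional, and $\mathcal S\colon Y\times Y\to[0,+\infty]$ is a functional with $\mathcal S(y,z)=0$ if and only if $y=z$. For a mapping $G\colon X\to Y$, $w\in Y$ and real $\gamma$, $t$ (with $\inf\emptyset=+\infty$): \[ \Phi(G,w,\gamma):=\{x\in X:\mathcal S(G(x),w)\le\gamma\},\quad v(G,w,\gamma):=\inf\{\mathcal R(x):x\in\Phi(G,w,\gamma)\}, \] \[ \Sigma(G,w,\gamma):=\{x\in\Phi(G,w,\gamma):\mathcal R(x)=v(G,w,\gamma)\},\quad \Phi_{\mathcal R}(G,w,\gamma,t):=\Phi(G,w,\gamma)\cap\{x\in X:\mathcal R(x)\le t\}. \] Elements of $\Sigma(F,y,0)$ are called $\mathcal R$-minimizing solutions of $F(x)=y$. $(y_k)$ converges $\mathcal S$-uniformly to $y$ if $\sup\{|\mathcal S(z,y_k)-\mathcal S(z,y)|:z\in Y\}\to0$. The topology $\tau_{\mathcal R}$ on $X$ is the one generated by all sets $U\cap\{x\in X:\mathcal R(x)>s\}$ with $U\in\tau$, $s\in\mathbb R$, and all sets $U\cap\{x\in X:\mathcal R(x)<t\}$ with $U\in\tau$, $t\in\mathbb R\cup\{\infty\}$. For a topology $\sigma$ on $X$ and a sequence $(\Sigma_k)$ of subsets of $X$, the upper limit is $\sigma\text{-}\limsup_{k}\Sigma_k:=\bigcap_{k\in\mathbb N}\operatorname{cl}_\sigma\bigl(\bigcup_{k'\ge k}\Sigma_{k'}\bigr)$, where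 $\operatorname{cl}_\sigma$ is the closure with respect to $\sigma$.
   Formalization: The sets Φ_R(F,w,γ,t) are assumed τ-closed as well as τ-compact (automatic if τ is Hausdorff); for arbitrary τ compactness alone fails: X = ℕ cofinite, Y = {y}, S = 0, R(n) = 1/(n+1), y_k = y, β_k = 0 makes every Σ empty. *)

theory Defs
  imports "HOL-Analysis.Analysis"
begin

text \<open>
  The sets \<open>X\<close> and \<open>Y\<close> are carrier sets; a topology on \<open>X\<close> is a \<open>T\<close> with \<open>topspace T = X\<close>.
  Functionals with values in \<open>[0, \<infinity>]\<close> are nonnegative \<open>ereal\<close>-valued functions rather than
  \<open>ennreal\<close>-valued ones, so that comparison with negative reals keeps its usual meaning.
\<close>

definition feasible :: "'a set \<Rightarrow> ('b \<Rightarrow> 'b \<Rightarrow> ereal) \<Rightarrow> ('a \<Rightarrow> 'b) \<Rightarrow> 'b \<Rightarrow> real \<Rightarrow> 'a set" where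
  "feasible X S G w \<gamma> = {x \<in> X. S (G x) w \<le> ereal \<gamma>}"

text \<open>The infimum is taken in \<open>ereal\<close>, so it is \<open>\<infinity>\<close> on the empty set.\<close>

definition optval ::
  "'a set \<Rightarrow> ('a \<Rightarrow> ereal) \<Rightarrow> ('b \<Rightarrow> 'b \<Rightarrow> ereal) \<Rightarrow> ('a \<Rightarrow> 'b) \<Rightarrow> 'b \<Rightarrow> real \<Rightarrow> ereal" where
  "optval X R S G w \<gamma> = (INF x\<in>feasible X S G w \<gamma>. R x)"

definition minimizers ::
  "'a set \<Rightarrow> ('a \<Rightarrow> ereal) \<Rightarrow> ('b \<Rightarrow> 'b \<Rightarrow> ereal) \<Rightarrow> ('a \<Rightarrow> 'b) \<Rightarrow> 'b \<Rightarrow> real \<Rightarrow> 'a set" where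
  "minimizers X R S G w \<gamma> = {x \<in> feasible X S G w \<gamma>. R x = optval X R S G w \<gamma>}"

text \<open>
  The theorem requires these sets to be compact and closed. Closedness is automatic in Hausdorff
  spaces (\<open>compactin_imp_closedin\<close>), but the topology here is arbitrary, and without it the minimum
  need not be attained: take \<open>R n = 1 / (n + 1)\<close> and \<open>S = 0\<close> on a singleton \<open>Y\<close>, with the cofinite
  topology on the naturals, in which every set is compact.
\<close>

definition feasible_sub ::
  "'a set \<Rightarrow> ('a \<Rightarrow> ereal) \<Rightarrow> ('b \<Rightarrow> 'b \<Rightarrow> ereal) \<Rightarrow> ('a \<Rightarrow> 'b) \<Rightarrow> 'b \<Rightarrow> real \<Rightarrow> real \<Rightarrow> 'a set" where
  "feasible_sub X R S G w \<gamma> t = feasible X S G w \<gamma> \<inter> {x \<in> X. R x \<le> ereal t}"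

text \<open>
  The distance \<open>\<bar>a - b\<bar>\<close> on \<open>[0, \<infinity>]\<close>, with \<open>\<bar>\<infinity> - \<infinity>\<bar> = 0\<close>; the library's
  \<open>\<infinity> - \<infinity> = \<infinity>\<close> would exclude uniform convergence whenever \<open>S\<close> attains \<open>\<infinity>\<close>.
\<close>

definition absdiff :: "ereal \<Rightarrow> ereal \<Rightarrow> ereal" where
  "absdiff a b = (if a = b then 0 else \<bar>a - b\<bar>)"

definition converges_S_uniformly ::
  "'b set \<Rightarrow> ('b \<Rightarrow> 'b \<Rightarrow> ereal) \<Rightarrow> (nat \<Rightarrow> 'b) \<Rightarrow> 'b \<Rightarrow> bool" where
  "converges_S_uniformly Y S ys y \<longleftrightarrow>
     (\<lambda>k. SUP z\<in>Y. absdiff (S z (ys k)) (S z y)) \<longlonglongrightarrow> 0"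

definition tau_R :: "'a topology \<Rightarrow> ('a \<Rightarrow> ereal) \<Rightarrow> 'a topology" where
  "tau_R T R = topology_generated_by
     ({U \<inter> {x \<in> topspace T. ereal s < R x} | U s. openin T U} \<union>
      {U \<inter> {x \<in> topspace T. R x < t} | U t. openin T U \<and> t \<noteq> -\<infinity>})"

definition upper_limit :: "'a topology \<Rightarrow> (nat \<Rightarrow> 'a set) \<Rightarrow> 'a set" where
  "upper_limit \<sigma> A = (\<Inter>k. \<sigma> closure_of (\<Union>k'\<in>{k..}. A k'))"

end

theory Submission
  imports Defs
begin

text \<open>
  Every solution of \<open>F x = y\<close> is feasible for the perturbed problems, so \<open>v(F, y\<^sub>k, \<beta>\<^sub>k) \<le> v(F, y, 0)\<close>.
  By uniform convergence the perturbed feasible sets are eventually contained in \<open>\<Phi>(F, y, \<gamma>)\<close>, for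
  every \<open>\<gamma> > 0\<close>. Hence, by compactness, points of the perturbed sublevel sets at a fixed level \<open>s\<close>
  that exist for infinitely many \<open>k\<close> cluster at an exact solution of level at most \<open>s\<close>. For \<open>s = v(F, y, 0)\<close>
  this shows that the \<open>\<tau>\<close>-upper limit of the minimizers is nonempty and consists of minimizers; for
  smaller \<open>s\<close> it shows that \<open>v(F, y\<^sub>k, \<beta>\<^sub>k)\<close> tends to \<open>v(F, y, 0)\<close>. As \<open>R\<close> therefore converges along the
  minimizers, their \<open>\<tau>\<close>-cluster points are also \<open>\<tau>\<^sub>R\<close>-cluster points.
\<close>

section \<open>Compactness and upper limits of sequences of sets\<close>

lemma compactin_decseq_Inter_nonempty:
  fixes C :: "nat \<Rightarrow> 'a set"
  assumes "compactin T K" and "\<And>n. closedin T (C n)" and "\<And>n. C n \<noteq> {}"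
    and "\<And>n. C n \<subseteq> K" and "decseq C"
  shows "(\<Inter>n. C n) \<noteq> {}"
\<comment> \<open>Cantor's intersection theorem speaks of a compact space, so the nest is viewed in
  the subspace \<open>K\<close>.\<close>
proof (rule compact_space_imp_nest)
  show "compact_space (subtopology T K)"
    using assms(1) by (simp add: compact_space_subtopology)
  show "closedin (subtopology T K) (C n)" for n
    using assms(2,4) by (rule closedin_subset_topspace)
qed (use assms in auto)

lemma upper_limit_subset:
  assumes K: "closedin T K" and ev: "\<forall>\<^sub>F k in sequentially. A k \<subseteq> K"
  shows "upper_limit T A \<subseteq> K"
proof -
  obtain N where "\<And>k. k \<ge> N \<Longrightarrow> A k \<subseteq> K"
    using ev by (auto simp: eventually_sequentially)
  then have "T closure_of (\<Union>k'\<in>{N..}. A k') \<subseteq> K"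
    by (intro closure_of_minimal K) auto
  then show ?thesis
    by (auto simp: upper_limit_def)
qed

text \<open>The closures of the tail unions form a decreasing nest of closed sets, eventually inside
  the compact set \<open>K\<close>. Nonemptiness of \<open>A k\<close> for infinitely many
  \<open>k\<close> keeps every tail nonempty.\<close>

lemma upper_limit_nonempty:
  assumes K: "compactin T K" "closedin T K" and ev: "\<forall>\<^sub>F k in sequentially. A k \<subseteq> K"
    and fr: "\<exists>\<^sub>F k in sequentially. A k \<noteq> {}"
  shows "upper_limit T A \<noteq> {}"
proof -
  obtain N where N: "\<And>k. k \<ge> N \<Longrightarrow> A k \<subseteq> K"
    using ev by (auto simp: eventually_sequentially)
  define C where "C n = T closure_of (\<Union>k'\<in>{n..}. A k')" for n
  have dec: "decseq C"
    unfolding decseq_def C_def by (intro allI impI closure_of_mono UN_mono) auto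
  \<comment> \<open>The shift by \<open>N\<close> brings the whole nest into \<open>K\<close>; as
    \<open>C\<close> decreases, it leaves the intersection unchanged.\<close>
  have "(\<Inter>n. C (n + N)) \<noteq> {}"
  proof (rule compactin_decseq_Inter_nonempty[OF K(1)])
    fix n
    have sub: "(\<Union>k'\<in>{n+N..}. A k') \<subseteq> K"
      using N by (meson UN_least add_leD2 atLeast_iff)
    show "C (n + N) \<subseteq> K"
      unfolding C_def by (rule closure_of_minimal[OF sub K(2)])
    obtain k where "k \<ge> n + N" "A k \<noteq> {}"
      using fr unfolding frequently_sequentially by blast
    then have "(\<Union>k'\<in>{n+N..}. A k') \<noteq> {}"
      by auto
    moreover have "(\<Union>k'\<in>{n+N..}. A k') \<subseteq> C (n + N)"
      unfolding C_def using sub closedin_subset[OF K(2)] by (intro closure_of_subset) blast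
    ultimately show "C (n + N) \<noteq> {}"
      by blast
  qed (use dec in \<open>auto simp: C_def decseq_def\<close>)
  moreover have "C (n + N) \<subseteq> C n" for n
    using dec by (simp add: decseq_def)
  ultimately have "(\<Inter>n. C n) \<noteq> {}"
    by blast
  then show ?thesis
    by (simp add: upper_limit_def C_def)
qed

section \<open>The topology \<open>tau_R\<close>\<close>

lemma openin_tau_R:
  assumes R: "\<And>x. x \<in> topspace T \<Longrightarrow> 0 \<le> R x" and U: "openin T U"
  shows "openin (tau_R T R) U"
proof -
  \<comment> \<open>Any negative threshold cuts off nothing, so \<open>U\<close> is itself a
    generator.\<close>
  have "U = U \<inter> {x \<in> topspace T. ereal (-1) < R x}"
    using openin_subset[OF U] R by (force intro: less_le_trans[of _ 0])
  with U show ?thesis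
    unfolding tau_R_def by (intro topology_generated_by_Basis) blast
qed

lemma topspace_tau_R:
  assumes "\<And>x. x \<in> topspace T \<Longrightarrow> 0 \<le> R x"
  shows "topspace (tau_R T R) = topspace T"
proof
  show "topspace (tau_R T R) \<subseteq> topspace T"
    unfolding tau_R_def topology_generated_by_topspace by auto
  show "topspace T \<subseteq> topspace (tau_R T R)"
    by (intro openin_subset openin_tau_R assms) auto
qed

text \<open>\<open>tau_R T R\<close> is finer than \<open>T\<close> on the same carrier, so its
  closures are smaller.\<close>

lemma upper_limit_tau_R_subset:
  assumes "\<And>x. x \<in> topspace T \<Longrightarrow> 0 \<le> R x"
  shows "upper_limit (tau_R T R) A \<subseteq> upper_limit T A"
proof -
  have "tau_R T R closure_of B \<subseteq> T closure_of B" for B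
  proof
    fix x assume "x \<in> tau_R T R closure_of B"
    then show "x \<in> T closure_of B"
      by (simp add: in_closure_of topspace_tau_R openin_tau_R assms)
  qed
  then show ?thesis
    unfolding upper_limit_def by blast
qed

text \<open>Induction on the generation of \<open>W\<close>: generators have this form with
  \<open>I\<close> an open ray, and intersections are taken separately in \<open>U\<close> and in
  \<open>I\<close>. This splits a neighbourhood into a condition on position and one on the value of
  \<open>R\<close>.\<close>

lemma tau_R_neighbourhood:
  assumes "openin (tau_R T R) W" "x \<in> W"
  shows "\<exists>U I. openin T U \<and> open I \<and> x \<in> U \<and> R x \<in> I \<and> {z \<in> U. R z \<in> I} \<subseteq> W"
proof -
  have "generate_topology_on ({U \<inter> {x \<in> topspace T. ereal s < R x} | U s. openin T U} \<union>
      {U \<inter> {x \<in> topspace T. R x < t} | U t. openin T U \<and> t \<noteq> -\<infinity>}) W"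
    using assms(1) unfolding tau_R_def openin_topology_generated_by_iff .
  then show ?thesis
    using assms(2)
  proof induction
    case (Int a b)
    obtain U I where
      "openin T U" "open I" "x \<in> U" "R x \<in> I" and a: "{z \<in> U. R z \<in> I} \<subseteq> a"
      using Int.IH(1) Int.prems by blast
    moreover obtain U' I' where
      "openin T U'" "open I'" "x \<in> U'" "R x \<in> I'" and b: "{z \<in> U'. R z \<in> I'} \<subseteq> b"
      using Int.IH(2) Int.prems by blast
    moreover have "{z \<in> U \<inter> U'. R z \<in> I \<inter> I'} \<subseteq> a \<inter> b"
      using a b by blast
    ultimately show ?case
      by (meson IntI open_Int openin_Int)
  next
    case (UN K)
    obtain k where k: "k \<in> K" "x \<in> k"
      using UN.prems by blast
    then obtain U I where
      "openin T U" "open I" "x \<in> U" "R x \<in> I" "{z \<in> U. R z \<in> I} \<subseteq> k"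
      using UN.IH by blast
    with k(1) show ?case
      by (meson Union_upper subset_trans)
  next
    case (Basis b)
    then consider U s where "openin T U" "b = U \<inter> {x \<in> topspace T. ereal s < R x}"
      | U t where "openin T U" "b = U \<inter> {x \<in> topspace T. R x < t}"
      by blast
    then show ?case
    proof cases
      case 1
      then show ?thesis
        using Basis openin_subset[OF 1(1)] by (intro exI[of _ U] exI[of _ "{ereal s<..}"]) auto
    next
      case 2
      then show ?thesis
        using Basis openin_subset[OF 2(1)] by (intro exI[of _ U] exI[of _ "{..<t}"]) auto
    qed
  qed simp
qed

text \<open>Late members of \<open>A\<close> satisfy the condition on the value of \<open>R\<close>
  by \<open>ev\<close>, and the closure in \<open>T\<close> supplies late members satisfying the
  condition on position.\<close>

lemma upper_limit_tau_R_I: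
  assumes R: "\<And>x. x \<in> topspace T \<Longrightarrow> 0 \<le> R x" and x: "x \<in> upper_limit T A"
    and ev: "\<And>I. open I \<Longrightarrow> R x \<in> I \<Longrightarrow> \<forall>\<^sub>F k in sequentially. R ` A k \<subseteq> I"
  shows "x \<in> upper_limit (tau_R T R) A"
proof -
  have cl: "x \<in> T closure_of (\<Union>k'\<in>{k..}. A k')" for k
    using x by (auto simp: upper_limit_def)
  have "\<exists>z\<in>W. z \<in> (\<Union>k'\<in>{k..}. A k')" if W: "openin (tau_R T R) W" "x \<in> W" for W k
  proof -
    obtain U I where U: "openin T U" "open I" "x \<in> U" "R x \<in> I" "{z \<in> U. R z \<in> I} \<subseteq> W"
      using tau_R_neighbourhood[OF W] by blast
    obtain N where N: "\<And>k. k \<ge> N \<Longrightarrow> R ` A k \<subseteq> I"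
      using ev[OF U(2,4)] by (auto simp: eventually_sequentially)
    obtain z k' where z: "z \<in> U" "k' \<ge> max k N" "z \<in> A k'"
      using cl[of "max k N"] U(1,3) unfolding in_closure_of by blast
    then have "z \<in> W"
      using U(5) N[of k'] by auto
    with z show ?thesis
      by auto
  qed
  moreover have "x \<in> topspace (tau_R T R)"
    using cl R by (simp add: in_closure_of topspace_tau_R)
  ultimately have "x \<in> tau_R T R closure_of (\<Union>k'\<in>{k..}. A k')" for k
    unfolding in_closure_of by metis
  then show ?thesis
    by (simp add: upper_limit_def)
qed

section \<open>Existence of minimizers\<close>

lemma optval_nonneg:
  assumes "\<And>x. x \<in> X \<Longrightarrow> 0 \<le> R x"
  shows "0 \<le> optval X R S G w \<gamma>"
  unfolding optval_def by (rule INF_greatest) (use assms in \<open>auto simp: feasible_def\<close>)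

text \<open>No feasible point has a value below \<open>t\<close>. In this form the minimizers fall
  under the compactness hypothesis.\<close>

lemma minimizers_eq_feasible_sub:
  assumes "optval X R S G w \<gamma> = ereal t"
  shows "minimizers X R S G w \<gamma> = feasible_sub X R S G w \<gamma> t"
proof -
  have "ereal t \<le> R x" if "x \<in> feasible X S G w \<gamma>" for x
    using INF_lower[OF that, of R] assms by (simp add: optval_def)
  then show ?thesis
    using assms by (auto simp: minimizers_def feasible_sub_def feasible_def intro: antisym)
qed

lemma minimizers_nonempty:
  assumes R: "\<And>x. x \<in> X \<Longrightarrow> 0 \<le> R x" and fin: "optval X R S G w \<gamma> < \<infinity>"
    and cpt: "\<And>t. 0 \<le> t \<Longrightarrow> compactin T (feasible_sub X R S G w \<gamma> t)"
    and cl: "\<And>t. 0 \<le> t \<Longrightarrow> closedin T (feasible_sub X R S G w \<gamma> t)"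
  shows "minimizers X R S G w \<gamma> \<noteq> {}"
proof -
  obtain v where v: "optval X R S G w \<gamma> = ereal v" "0 \<le> v"
    using fin optval_nonneg[of X R S G w \<gamma>, OF R] by (cases "optval X R S G w \<gamma>") simp_all
  \<comment> \<open>Levels strictly above the infimum make each set nonempty before attainment is
    known; a common point has level at most \<open>v\<close>.\<close>
  define C where "C n = feasible_sub X R S G w \<gamma> (v + 1 / Suc n)" for n
  have dec: "decseq C"
  proof (unfold decseq_def, intro allI impI)
    fix m n :: nat assume "m \<le> n"
    then have "ereal (v + 1 / Suc n) \<le> ereal (v + 1 / Suc m)"
      by (simp add: frac_le)
    then show "C n \<subseteq> C m"
      unfolding C_def feasible_sub_def using order_trans by blast
  qed
  have "(\<Inter>n. C n) \<noteq> {}"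
  proof (rule compactin_decseq_Inter_nonempty[OF _ _ _ _ dec])
    show "compactin T (C 0)" and "closedin T (C n)" for n
      using cpt cl v by (simp_all add: C_def)
    fix n
    have "optval X R S G w \<gamma> < ereal (v + 1 / Suc n)"
      using v by simp
    then obtain x where "x \<in> feasible X S G w \<gamma>" "R x < ereal (v + 1 / Suc n)"
      unfolding optval_def INF_less_iff by blast
    then show "C n \<noteq> {}"
      by (auto simp: C_def feasible_sub_def feasible_def intro: less_imp_le)
    show "C n \<subseteq> C 0"
      using dec by (simp add: decseq_def)
  qed
  then obtain x where x: "\<And>n. x \<in> C n"
    by blast
  have "R x \<le> ereal v"
  proof (rule LIMSEQ_le_const)
    show "(\<lambda>n. ereal (v + 1 / Suc n)) \<longlonglongrightarrow> ereal v"
      using tendsto_add[OF tendsto_const[of v] LIMSEQ_inverse_real_of_nat]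
      by (simp add: inverse_eq_divide)
    show "\<exists>N. \<forall>n\<ge>N. R x \<le> ereal (v + 1 / Suc n)"
      using x by (auto simp: C_def feasible_sub_def)
  qed
  then have "x \<in> feasible_sub X R S G w \<gamma> v"
    using x[of 0] by (auto simp: C_def feasible_sub_def)
  then show ?thesis
    using minimizers_eq_feasible_sub[OF v(1)] by blast
qed

section \<open>Stability of the feasible sets\<close>

lemma le_add_absdiff: "(b::ereal) \<le> a + absdiff a b" if "0 \<le> a" "0 \<le> b"
  using that by (cases a; cases b) (auto simp: absdiff_def)

text \<open>The discrepancy and the change of data each contribute at most half of
  \<open>\<gamma>\<close>; since the convergence is uniform, one \<open>k\<close> serves all points
  \<open>F x\<close>.\<close>

lemma eventually_feasible_subset:
  assumes S: "\<And>w z. w \<in> Y \<Longrightarrow> z \<in> Y \<Longrightarrow> 0 \<le> S w z" and F: "F \<in> X \<rightarrow> Y" and y: "y \<in> Y"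
    and ys: "\<And>k. ys k \<in> Y" and conv: "converges_S_uniformly Y S ys y"
    and \<beta>: "\<beta> \<longlonglongrightarrow> 0" and \<gamma>: "0 < \<gamma>"
  shows "\<forall>\<^sub>F k in sequentially. feasible X S F (ys k) (\<beta> k) \<subseteq> feasible X S F y \<gamma>"
proof -
  have "\<forall>\<^sub>F k in sequentially. (SUP z\<in>Y. absdiff (S z (ys k)) (S z y)) < ereal (\<gamma> / 2)"
    using conv \<gamma> unfolding converges_S_uniformly_def by (intro order_tendstoD(2)) auto
  moreover have "\<forall>\<^sub>F k in sequentially. \<beta> k < \<gamma> / 2"
    using \<beta> \<gamma> by (intro order_tendstoD(2)) auto
  ultimately show ?thesis
  proof eventually_elim
    case (elim k)
    show ?case
    proof
      fix x assume x: "x \<in> feasible X S F (ys k) (\<beta> k)"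
      then have Fx: "F x \<in> Y"
        using F by (auto simp: feasible_def)
      have "S (F x) y \<le> S (F x) (ys k) + absdiff (S (F x) (ys k)) (S (F x) y)"
        by (intro le_add_absdiff S Fx ys y)
      also have "\<dots> \<le> ereal (\<gamma> / 2) + ereal (\<gamma> / 2)"
      proof (rule add_mono)
        have "S (F x) (ys k) \<le> ereal (\<beta> k)"
          using x by (simp add: feasible_def)
        also have "\<dots> \<le> ereal (\<gamma> / 2)"
          using elim(2) by simp
        finally show "S (F x) (ys k) \<le> ereal (\<gamma> / 2)" .
        show "absdiff (S (F x) (ys k)) (S (F x) y) \<le> ereal (\<gamma> / 2)"
          using SUP_upper[OF Fx, of "\<lambda>z. absdiff (S z (ys k)) (S z y)"] elim(1) by simp
      qed
      finally show "x \<in> feasible X S F y \<gamma>"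
        using x by (simp add: feasible_def)
    qed
  qed
qed

theorem theorem3p10:
  fixes X :: "'a set" and Y :: "'b set"
    and R :: "'a \<Rightarrow> ereal" and S :: "'b \<Rightarrow> 'b \<Rightarrow> ereal"
    and T :: "'a topology" and F :: "'a \<Rightarrow> 'b"
    and y :: 'b and ys :: "nat \<Rightarrow> 'b" and \<beta> :: "nat \<Rightarrow> real"
  assumes R_nonneg: "\<And>x. x \<in> X \<Longrightarrow> 0 \<le> R x"
    and S_nonneg: "\<And>w z. w \<in> Y \<Longrightarrow> z \<in> Y \<Longrightarrow> 0 \<le> S w z"
    and S_zero_iff: "\<And>w z. w \<in> Y \<Longrightarrow> z \<in> Y \<Longrightarrow> S w z = 0 \<longleftrightarrow> w = z"
    and T_on_X: "topspace T = X"
    and F_maps: "F \<in> X \<rightarrow> Y"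
    and y_in: "y \<in> Y"
    and y_attained: "\<exists>x\<in>X. F x = y \<and> R x < \<infinity>"
    and compact: "\<And>w \<gamma> t. w \<in> Y \<Longrightarrow> 0 \<le> \<gamma> \<Longrightarrow> 0 \<le> t \<Longrightarrow>
        compactin T (feasible_sub X R S F w \<gamma> t) \<and> closedin T (feasible_sub X R S F w \<gamma> t)"
    and ys_in: "\<And>k. ys k \<in> Y"
    and ys_conv: "converges_S_uniformly Y S ys y"
    and ys_bound: "\<And>k. S y (ys k) \<le> ereal (\<beta> k)"
    and beta_lim: "\<beta> \<longlonglongrightarrow> 0"
  shows "limsup (\<lambda>k. optval X R S F (ys k) (\<beta> k)) \<le> optval X R S F y 0
       \<and> optval X R S F y 0 < \<infinity>
       \<and> upper_limit (tau_R T R) (\<lambda>k. minimizers X R S F (ys k) (\<beta> k)) \<noteq> {}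
       \<and> upper_limit (tau_R T R) (\<lambda>k. minimizers X R S F (ys k) (\<beta> k)) \<subseteq> minimizers X R S F y 0
       \<and> (\<forall>xd. minimizers X R S F y 0 = {xd} \<longrightarrow>
              {xd} = upper_limit (tau_R T R) (\<lambda>k. minimizers X R S F (ys k) (\<beta> k)))"
proof -
  let ?\<Phi> = "feasible X S F" and ?\<Phi>R = "feasible_sub X R S F" and ?v = "optval X R S F"
  let ?M = "\<lambda>k. minimizers X R S F (ys k) (\<beta> k)"
  have R_top: "0 \<le> R x" if "x \<in> topspace T" for x
    using that R_nonneg T_on_X by simp
  have \<beta>_nonneg: "0 \<le> \<beta> k" for k
    using S_nonneg[OF y_in ys_in, of k] ys_bound[of k] by (metis ereal_less_eq(5) order_trans)
  have feas0: "F x = y" if "x \<in> ?\<Phi> y 0" for x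
  proof -
    have "F x \<in> Y" "S (F x) y \<le> 0"
      using that F_maps by (auto simp: feasible_def zero_ereal_def)
    then show ?thesis
      using S_nonneg[of "F x" y] S_zero_iff[of "F x" y] y_in by auto
  qed
  have S_yy: "S y y = 0"
    using S_zero_iff y_in by blast
  have le_v: "?v (ys k) (\<beta> k) \<le> ?v y 0" for k
    unfolding optval_def
  proof (rule INF_superset_mono)
    \<comment> \<open>For an exact solution the discrepancy from \<open>ys k\<close> is
      \<open>S y (ys k)\<close>, which is at most \<open>\<beta> k\<close>.\<close>
    show "?\<Phi> y 0 \<subseteq> ?\<Phi> (ys k) (\<beta> k)"
      using feas0 ys_bound by (auto simp: feasible_def)
  qed simp
  have v_fin: "?v y 0 < \<infinity>"
    using y_attained S_yy unfolding optval_def INF_less_iff by (auto simp: feasible_def zero_ereal_def)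
  obtain v where v: "?v y 0 = ereal v" "0 \<le> v"
    using v_fin optval_nonneg[of X R S F y 0, OF R_nonneg] by (cases "?v y 0") simp_all
  have M_ne: "?M k \<noteq> {}" for k
    using compact[OF ys_in \<beta>_nonneg] le_less_trans[OF le_v v_fin]
    by (intro minimizers_nonempty[where T = T] R_nonneg) auto
  have ev_sub: "\<forall>\<^sub>F k in sequentially. ?\<Phi>R (ys k) (\<beta> k) s \<subseteq> ?\<Phi>R y \<gamma> s" if "0 < \<gamma>" for \<gamma> s
    using eventually_feasible_subset[OF S_nonneg F_maps y_in ys_in ys_conv beta_lim that]
    by (auto simp: feasible_sub_def elim: eventually_mono)
  \<comment> \<open>The closed set at every tolerance \<open>\<gamma> > 0\<close> contains the upper
    limit; letting \<open>\<gamma>\<close> tend to 0 gives exact solutions. The level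
    \<open>s\<close> stays free because it is used both at \<open>v\<close> and below it.\<close>
  have cluster: "upper_limit T A \<subseteq> ?\<Phi>R y 0 s"
    if s: "0 \<le> s" and A: "\<And>k. A k \<subseteq> ?\<Phi>R (ys k) (\<beta> k) s" for A s
  proof
    fix x assume x: "x \<in> upper_limit T A"
    have in_\<gamma>: "x \<in> ?\<Phi>R y \<gamma> s" if "0 < \<gamma>" for \<gamma>
    proof -
      have "upper_limit T A \<subseteq> ?\<Phi>R y \<gamma> s"
        using compact[OF y_in _ s, of \<gamma>] that
        by (intro upper_limit_subset eventually_mono[OF ev_sub[OF that, of s]] subset_trans[OF A]) auto
      then show ?thesis
        using x by blast
    qed
    have "S (F x) y \<le> 0"
    proof (rule ereal_le_epsilon2)
      fix e :: real assume "0 < e"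
      then show "S (F x) y \<le> 0 + ereal e"
        using in_\<gamma>[of e] by (simp add: feasible_sub_def feasible_def)
    qed
    then show "x \<in> ?\<Phi>R y 0 s"
      using in_\<gamma>[of 1] by (simp add: feasible_sub_def feasible_def zero_ereal_def)
  qed
  \<comment> \<open>Any positive tolerance would provide the compact set; 1 is chosen.\<close>
  have cluster_ne: "upper_limit T A \<noteq> {}"
    if s: "0 \<le> s" and A: "\<And>k. A k \<subseteq> ?\<Phi>R (ys k) (\<beta> k) s"
      and fr: "\<exists>\<^sub>F k in sequentially. A k \<noteq> {}" for A s
    using compact[OF y_in zero_le_one s]
    by (intro upper_limit_nonempty[OF _ _ _ fr, of T "?\<Phi>R y 1 s"]
        eventually_mono[OF ev_sub[OF zero_less_one, of s]] subset_trans[OF A]) auto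
  have M_sub: "?M k \<subseteq> ?\<Phi>R (ys k) (\<beta> k) v" for k
    using le_v[of k] v by (auto simp: minimizers_def feasible_sub_def feasible_def)
  have M0: "minimizers X R S F y 0 = ?\<Phi>R y 0 v"
    by (rule minimizers_eq_feasible_sub[OF v(1)])
  have sub: "upper_limit T ?M \<subseteq> minimizers X R S F y 0"
    unfolding M0 by (rule cluster[OF v(2) M_sub])
  \<comment> \<open>Otherwise the perturbed sublevel sets at level \<open>a\<close> are nonempty
    infinitely often, and they cluster at an exact solution with a value below the optimum.\<close>
  have lower: "\<forall>\<^sub>F k in sequentially. a < ?v (ys k) (\<beta> k)" if a: "a < ?v y 0" for a
  proof (rule ccontr)
    assume "\<not> (\<forall>\<^sub>F k in sequentially. a < ?v (ys k) (\<beta> k))"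
    then have fr: "\<exists>\<^sub>F k in sequentially. ?v (ys k) (\<beta> k) \<le> a"
      by (simp add: frequently_def not_le)
    then obtain k where "?v (ys k) (\<beta> k) \<le> a"
      using frequently_ex by blast
    with optval_nonneg[OF R_nonneg] have "0 \<le> a"
      by (rule order_trans)
    \<comment> \<open>Compactness is assumed only for finite nonnegative levels.\<close>
    then obtain s where s: "a = ereal s" "0 \<le> s"
      using a v by (cases a) auto
    have "\<exists>\<^sub>F k in sequentially. ?\<Phi>R (ys k) (\<beta> k) s \<noteq> {}"
      using fr
    proof (rule frequently_elim1)
      fix k assume k: "?v (ys k) (\<beta> k) \<le> a"
      obtain x where "x \<in> ?M k"
        using M_ne by blast
      then have "x \<in> ?\<Phi>R (ys k) (\<beta> k) s"
        using k s by (auto simp: minimizers_def feasible_sub_def feasible_def)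
      then show "?\<Phi>R (ys k) (\<beta> k) s \<noteq> {}"
        by blast
    qed
    then obtain x where "x \<in> ?\<Phi>R y 0 s"
      using cluster[OF s(2) subset_refl] cluster_ne[OF s(2) subset_refl] by blast
    then have "?v y 0 \<le> R x" "R x \<le> a"
      using s by (auto simp: feasible_sub_def optval_def intro: INF_lower)
    then show False
      using a by simp
  qed
  have v_lim: "(\<lambda>k. ?v (ys k) (\<beta> k)) \<longlonglongrightarrow> ?v y 0"
    by (intro order_tendstoI lower always_eventually allI le_less_trans[OF le_v])
  obtain x where x: "x \<in> upper_limit T ?M"
    using cluster_ne[OF v(2) M_sub] M_ne by auto
  \<comment> \<open>On \<open>?M k\<close> the functional \<open>R\<close> is constant with value
    \<open>?v (ys k) (\<beta> k)\<close>, and these values tend to \<open>R x\<close>.\<close>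
  have "x \<in> upper_limit (tau_R T R) ?M"
  proof (rule upper_limit_tau_R_I[OF R_top x])
    fix I assume I: "open I" "R x \<in> I"
    have "R x = ?v y 0"
      using x sub by (auto simp: minimizers_def)
    then have "\<forall>\<^sub>F k in sequentially. ?v (ys k) (\<beta> k) \<in> I"
      using topological_tendstoD[OF v_lim I(1)] I(2) by simp
    then show "\<forall>\<^sub>F k in sequentially. R ` ?M k \<subseteq> I"
      by eventually_elim (auto simp: minimizers_def)
  qed
  moreover have "upper_limit (tau_R T R) ?M \<subseteq> minimizers X R S F y 0"
    using upper_limit_tau_R_subset[OF R_top] sub by (rule subset_trans)
  moreover have "limsup (\<lambda>k. ?v (ys k) (\<beta> k)) \<le> ?v y 0"
    using le_v by (intro Limsup_bounded) simp
  ultimately show ?thesis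
    \<comment> \<open>In the unique case, a nonempty subset of a singleton is the whole
      singleton.\<close>
    using v_fin by (metis empty_iff subset_singletonD)
qed

end
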